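(* Let $G=(V,E)$ be a finite simple graph, let $c:E\to\{1,\dots,q\}$ be a proper edge colouring, and let $R=\mathbb C^q=\bigoplus_{\alpha=1}^q\mathbb C\varepsilon_\alpha$ with $\varepsilon_\alpha\varepsilon_\beta=\delta_{\alpha\beta}\varepsilon_\alpha$. For arbitrary nonzero complex numbers $\gamma_{ij}=\gamma_{ji}$ ($ij\in E$), set $$w_{ij}=\gamma_{ij}\,\varepsilon_{c(ij)}\quad(ij\in E),\qquad w_{ij}=0\quad(ij\notin E).$$ Then the graph bracket $[f,g]_i=\sum_j w_{ij}(f_ig_j-f_jg_i)$ on $R^V$ satisfies the Jacobi identity. Consequently every finite simple graph $G$ admits such a realization (a proper edge colouring $c$ with $q$ colours together with weights of the form $w_{ij}=\gamma_{ij}\,\varepsilon_{c(ij)}$ with $\gamma_{ij}=\gamma_{ji}\in\mathbb C\setminus\{0\}$ for $ij\in E$ and $w_{ij}=0$ for $ij\notin E$, nonzero on every edge, whose bracket satisfies Jacobi) with $q\le\Delta(G)+1$, where $\Delta(G)$ is the maximum degree of $G$.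
   Context: A proper edge colouring assigns different colours to any two distinct edges sharing a vertex. $\mathbb C^q$ carries componentwise multiplication. The Jacobi identity is $[f,[g,h]]+[g,[h,f]]+[h,[f,g]]=0$ for all $f,g,h\in R^V$. *)

theory Defs
  imports Complex_Main "HOL-Library.Function_Algebras"
begin

definition finite_simple_graph :: "'a set \<Rightarrow> 'a set set \<Rightarrow> bool" where
  "finite_simple_graph V E \<longleftrightarrow> finite V \<and> (\<forall>e\<in>E. e \<subseteq> V \<and> card e = 2)"

definition degree :: "'a set set \<Rightarrow> 'a \<Rightarrow> nat" where
  "degree E v = card {e \<in> E. v \<in> e}"

text \<open>The inserted 0 only matters for the graph without vertices, whose maximum degree is
  taken to be 0.\<close>

definition max_degree :: "'a set \<Rightarrow> 'a set set \<Rightarrow> nat" where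
  "max_degree V E = Max (insert 0 (degree E ` V))"

definition proper_edge_colouring :: "'a set set \<Rightarrow> nat \<Rightarrow> ('a set \<Rightarrow> nat) \<Rightarrow> bool" where
  "proper_edge_colouring E q c \<longleftrightarrow>
     (\<forall>e\<in>E. c e \<in> {1..q}) \<and>
     (\<forall>e\<in>E. \<forall>e'\<in>E. e \<noteq> e' \<and> e \<inter> e' \<noteq> {} \<longrightarrow> c e \<noteq> c e')"

text \<open>Since \<open>q\<close> is quantified inside the statement, the ring \<open>\<complex>\<^sup>q\<close> is a subset of the ring
  \<open>nat \<Rightarrow> complex\<close> (with the pointwise operations of \<^theory>\<open>HOL-Library.Function_Algebras\<close>):
  vectors indexed by \<open>1, \<dots>, q\<close> and extended by zero. Its unit is the indicator function of
  \<open>{1..q}\<close>, not the constant function 1.\<close>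

definition Cpow :: "nat \<Rightarrow> (nat \<Rightarrow> complex) set" where
  "Cpow q = {x. \<forall>\<alpha>. \<alpha> \<notin> {1..q} \<longrightarrow> x \<alpha> = 0}"

definition idem :: "nat \<Rightarrow> nat \<Rightarrow> complex" where
  "idem \<alpha> = (\<lambda>\<beta>. if \<beta> = \<alpha> then 1 else 0)"

definition cscale :: "complex \<Rightarrow> (nat \<Rightarrow> complex) \<Rightarrow> nat \<Rightarrow> complex" where
  "cscale a x = (\<lambda>\<beta>. a * x \<beta>)"

text \<open>\<open>R\<^sup>V\<close>; again functions on \<open>V\<close> are extended by zero, so that equality in \<open>R\<^sup>V\<close> is equality
  of functions.\<close>

definition functions_on :: "'a set \<Rightarrow> 'r::zero set \<Rightarrow> ('a \<Rightarrow> 'r) set" where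
  "functions_on V R = {f. (\<forall>i\<in>V. f i \<in> R) \<and> (\<forall>i. i \<notin> V \<longrightarrow> f i = 0)}"

definition graph_bracket ::
    "'a set \<Rightarrow> ('a \<Rightarrow> 'a \<Rightarrow> 'r::ring) \<Rightarrow> ('a \<Rightarrow> 'r) \<Rightarrow> ('a \<Rightarrow> 'r) \<Rightarrow> 'a \<Rightarrow> 'r" where
  "graph_bracket V w f g =
     (\<lambda>i. if i \<in> V then (\<Sum>j\<in>V. w i j * (f i * g j - f j * g i)) else 0)"

definition jacobi_on :: "'b::{plus,zero} set \<Rightarrow> ('b \<Rightarrow> 'b \<Rightarrow> 'b) \<Rightarrow> bool" where
  "jacobi_on A br \<longleftrightarrow>
     (\<forall>f\<in>A. \<forall>g\<in>A. \<forall>h\<in>A. br f (br g h) + br g (br h f) + br h (br f g) = 0)"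

definition edge_scalars :: "'a set set \<Rightarrow> ('a \<Rightarrow> 'a \<Rightarrow> complex) \<Rightarrow> bool" where
  "edge_scalars E \<gamma> \<longleftrightarrow> (\<forall>i j. {i, j} \<in> E \<longrightarrow> \<gamma> i j = \<gamma> j i \<and> \<gamma> i j \<noteq> 0)"

definition colour_weight ::
    "'a set set \<Rightarrow> ('a set \<Rightarrow> nat) \<Rightarrow> ('a \<Rightarrow> 'a \<Rightarrow> complex) \<Rightarrow> 'a \<Rightarrow> 'a \<Rightarrow> nat \<Rightarrow> complex" where
  "colour_weight E c \<gamma> i j = (if {i, j} \<in> E then cscale (\<gamma> i j) (idem (c {i, j})) else 0)"

lemma idem_mult: "idem \<alpha> * idem \<beta> = (if \<alpha> = \<beta> then idem \<alpha> else 0)"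
  by (auto simp: idem_def fun_eq_iff)

lemma Cpow_eq: "Cpow q = {x. \<exists>a. x = (\<Sum>\<alpha>=1..q. cscale (a \<alpha>) (idem \<alpha>))}"
proof -
  have s: "(\<Sum>\<alpha>\<in>A. F \<alpha>) \<beta> = (\<Sum>\<alpha>\<in>A. F \<alpha> \<beta>)" for A \<beta> and F :: "nat \<Rightarrow> nat \<Rightarrow> complex"
    by (induction A rule: infinite_finite_induct) auto
  have e: "(\<Sum>\<alpha>=1..q. cscale (a \<alpha>) (idem \<alpha>)) = (\<lambda>\<beta>. if \<beta> \<in> {1..q} then a \<beta> else 0)" for a
    by (rule ext) (simp add: s cscale_def idem_def if_distrib cong: if_cong)
  show ?thesis
    unfolding e Cpow_def by (auto simp: fun_eq_iff)
qed

lemma colour_weight_in_Cpow: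
  "proper_edge_colouring E q c \<Longrightarrow> colour_weight E c \<gamma> i j \<in> Cpow q"
  by (auto simp: proper_edge_colouring_def colour_weight_def Cpow_def cscale_def idem_def)

lemma graph_bracket_closed:
  assumes "\<And>i j. w i j \<in> Cpow q"
    and "f \<in> functions_on V (Cpow q)" "g \<in> functions_on V (Cpow q)"
  shows "graph_bracket V w f g \<in> functions_on V (Cpow q)"
proof -
  have s: "(\<Sum>j\<in>A. F j) \<beta> = (\<Sum>j\<in>A. F j \<beta>)" for A \<beta> and F :: "'a \<Rightarrow> nat \<Rightarrow> complex"
    by (induction A rule: infinite_finite_induct) auto
  show ?thesis
    using assms(1) by (auto simp: functions_on_def graph_bracket_def Cpow_def s)
qed

end

theory Submission
  imports Defs "HOL-Combinatorics.Transposition"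
begin

text \<open>In the coordinate \<open>\<alpha>\<close> the bracket only sees the edges of colour \<open>\<alpha>\<close>, which form a
  matching. So it splits into two-dimensional algebras with an antisymmetric product, and such
  an algebra always satisfies the Jacobi identity.

  The bound on \<open>q\<close> is Vizing's theorem, proved by adding one edge \<open>x y\<^sub>0\<close> at a time. Take a
  longest fan \<open>y\<^sub>0, \<dots>, y\<^sub>k\<close> at \<open>x\<close> (the colour of \<open>x y\<^sub>i\<^sub>+\<^sub>1\<close> is missing at \<open>y\<^sub>i\<close>), a colour \<open>a\<close>
  missing at \<open>x\<close> and a colour \<open>b\<close> missing at \<open>y\<^sub>k\<close>. If \<open>b\<close> is missing at \<open>x\<close>, shift the colours
  along the fan. Otherwise \<open>b\<close> is the colour of some \<open>x y\<^sub>j\<close>, and \<open>x\<close>, \<open>y\<^sub>j\<^sub>-\<^sub>1\<close>, \<open>y\<^sub>k\<close> are ends of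
  \<open>a\<close>-\<open>b\<close> paths. As a path has only two ends, the path of \<open>y\<^sub>j\<^sub>-\<^sub>1\<close> or that of \<open>y\<^sub>k\<close> avoids \<open>x\<close>;
  swapping \<open>a\<close> and \<open>b\<close> on it makes \<open>a\<close> missing at both ends of a fan.\<close>

section \<open>The Jacobi identity\<close>

lemma sum_fun_apply: "(\<Sum>j\<in>A. F j) x = (\<Sum>j\<in>A. F j x)"
  by (induction A rule: infinite_finite_induct) auto

lemma graph_bracket_apply:
  assumes "i \<in> V"
  shows "graph_bracket V (colour_weight E c \<gamma>) f g i \<alpha> =
    (\<Sum>j\<in>V. if {i, j} \<in> E \<and> c {i, j} = \<alpha> then \<gamma> i j * (f i \<alpha> * g j \<alpha> - f j \<alpha> * g i \<alpha>) else 0)"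
  using assms unfolding graph_bracket_def
  by (auto simp: sum_fun_apply colour_weight_def cscale_def idem_def intro!: sum.cong)

lemma graph_bracket_eq_0:
  assumes "\<And>j. \<lbrakk>j \<in> V; {i, j} \<in> E\<rbrakk> \<Longrightarrow> c {i, j} \<noteq> \<alpha>"
  shows "graph_bracket V (colour_weight E c \<gamma>) f g i \<alpha> = 0"
proof (cases "i \<in> V")
  case True
  then show ?thesis
    by (auto simp: graph_bracket_apply intro!: sum.neutral dest: assms)
qed (simp add: graph_bracket_def)

text \<open>By properness \<open>j\<close> is the only vertex joined to \<open>i\<close> by an edge
  of colour \<alpha>, so a single summand survives.\<close>

lemma graph_bracket_edge:
  assumes "finite V" "proper_edge_colouring E q c"
    and "i \<in> V" "j \<in> V" "{i, j} \<in> E" "c {i, j} = \<alpha>"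
  shows "graph_bracket V (colour_weight E c \<gamma>) f g i \<alpha> =
    \<gamma> i j * (f i \<alpha> * g j \<alpha> - f j \<alpha> * g i \<alpha>)"
proof -
  have "({i, k} \<in> E \<and> c {i, k} = \<alpha>) = (k = j)" for k
    using assms(2,5,6) unfolding proper_edge_colouring_def
    by (metis doubleton_eq_iff insertI1 disjoint_iff)
  then show ?thesis
    using assms(1,3,4) by (simp add: graph_bracket_apply)
qed

lemma jacobi_on_colour_weight:
  fixes V :: "'a set"
  assumes G: "finite_simple_graph V E" and c: "proper_edge_colouring E q c"
    and \<gamma>: "edge_scalars E \<gamma>"
  shows "jacobi_on A (graph_bracket V (colour_weight E c \<gamma>))"
proof -
  let ?B = "graph_bracket V (colour_weight E c \<gamma>)"
  have "(?B f (?B g h) + ?B g (?B h f) + ?B h (?B f g)) i \<alpha> = 0" for f g h i \<alpha>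
  proof (cases "\<exists>j. {i, j} \<in> E \<and> c {i, j} = \<alpha>")
    case True
    then obtain j where j: "{i, j} \<in> E" "c {i, j} = \<alpha>"
      by blast
    then have j': "{j, i} \<in> E" "c {j, i} = \<alpha>"
      by (simp_all add: insert_commute)
    have V: "finite V" "i \<in> V" "j \<in> V"
      using G j(1) by (auto simp: finite_simple_graph_def)
    have Bi: "?B f g i \<alpha> = \<gamma> i j * (f i \<alpha> * g j \<alpha> - f j \<alpha> * g i \<alpha>)" for f g
      using graph_bracket_edge[OF V(1) c V(2,3) j] .
    have Bj: "?B f g j \<alpha> = \<gamma> j i * (f j \<alpha> * g i \<alpha> - f i \<alpha> * g j \<alpha>)" for f g
      using graph_bracket_edge[OF V(1) c V(3,2) j'] .
    \<comment> \<open>Symmetry makes the bracket at \<open>j\<close> minus the bracket at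
      \<open>i\<close>. In the coordinate \<alpha> the cyclic sum is then, up to a factor, the
      determinant with rows \<open>(f i + f j, f i, f j)\<close> and likewise for \<open>g\<close>
      and \<open>h\<close>; its first column is the sum of the other two.\<close>
    have "\<gamma> j i = \<gamma> i j"
      using \<gamma> j(1) unfolding edge_scalars_def by metis
    then show ?thesis
      by (simp add: Bi Bj) (simp add: algebra_simps)
  next
    case False
    then show ?thesis
      by (simp add: graph_bracket_eq_0)
  qed
  then show ?thesis
    by (auto simp: jacobi_on_def fun_eq_iff)
qed

section \<open>Missing colours and Kempe changes\<close>

lemma proper_edge_colouringI:
  assumes "\<And>e. e \<in> E \<Longrightarrow> c e \<in> {1..q}"
    and "\<And>e e' v. \<lbrakk>e \<in> E; e' \<in> E; e \<noteq> e'; v \<in> e; v \<in> e'\<rbrakk> \<Longrightarrow> c e \<noteq> c e'"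
  shows "proper_edge_colouring E q c"
  unfolding proper_edge_colouring_def using assms by (metis disjoint_iff)

lemma proper_edge_colouringD:
  assumes "proper_edge_colouring E q c"
  shows proper_edge_colouring_range: "e \<in> E \<Longrightarrow> c e \<in> {1..q}"
    and proper_edge_colouring_inj:
      "\<lbrakk>e \<in> E; e' \<in> E; v \<in> e; v \<in> e'; c e = c e'\<rbrakk> \<Longrightarrow> e = e'"
  using assms unfolding proper_edge_colouring_def by (metis, metis disjoint_iff)

definition missing :: "'a set set \<Rightarrow> ('a set \<Rightarrow> nat) \<Rightarrow> 'a \<Rightarrow> nat \<Rightarrow> bool" where
  "missing F c v a \<longleftrightarrow> (\<forall>e\<in>F. v \<in> e \<longrightarrow> c e \<noteq> a)"

text \<open>Pigeonhole: fewer than \<open>q\<close> edges at \<open>v\<close> cannot carry all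
  \<open>q\<close> colours.\<close>

lemma missing_ex:
  assumes "finite F" "degree F v < q"
  shows "\<exists>a\<in>{1..q}. missing F c v a"
proof (rule ccontr)
  assume "\<not> ?thesis"
  then have "{1..q} \<subseteq> c ` {e \<in> F. v \<in> e}"
    by (auto simp: missing_def)
  then have "card {1..q} \<le> card {e \<in> F. v \<in> e}"
    using assms(1) by (intro surj_card_le) simp_all
  then show False
    using assms(2) by (simp add: degree_def)
qed

section \<open>Connectivity and the ends of paths\<close>

definition adj :: "'a set set \<Rightarrow> ('a \<times> 'a) set" where
  "adj F = {(s, t). {s, t} \<in> F}"

lemma adj_rtrancl_sym: "(u, v) \<in> (adj F)\<^sup>* \<Longrightarrow> (v, u) \<in> (adj F)\<^sup>*"
  by (rule symD[OF sym_rtrancl]) (auto simp: sym_def adj_def insert_commute)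

lemma adj_rtrancl_isolated:
  assumes "(u, v) \<in> (adj F)\<^sup>*" "\<And>e. e \<in> F \<Longrightarrow> v \<notin> e"
  shows "u = v"
  using assms by (auto simp: adj_def elim: rtranclE)

text \<open>A walk can enter and leave \<open>x\<close> only through \<open>x'\<close>. Recording
  \<open>x'\<close> whenever the walk is at \<open>x\<close> turns every use of the deleted edge
  into standing still.\<close>

lemma adj_rtrancl_remove_leaf:
  assumes "(s, w) \<in> (adj F)\<^sup>*" "s \<noteq> x" and leaf: "\<And>e. \<lbrakk>e \<in> F; x \<in> e\<rbrakk> \<Longrightarrow> e = {x, x'}"
  shows "(s, if w = x then x' else w) \<in> (adj (F - {{x, x'}}))\<^sup>*"
  using assms(1)
proof induction
  case base
  then show ?case using assms(2) by simp
next
  case (step t w)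
  have tw: "{t, w} \<in> F"
    using step.hyps by (simp add: adj_def)
  show ?case
  proof (cases "t = x \<or> w = x")
    case True
    then have "{t, w} = {x, x'}"
      using leaf[OF tw] by auto
    then show ?thesis
      using step.IH by (auto simp: doubleton_eq_iff split: if_splits)
  next
    case False
    then have "(t, w) \<in> adj (F - {{x, x'}})"
      using tw by (auto simp: adj_def doubleton_eq_iff)
    then show ?thesis
      using step.IH False by auto
  qed
qed

lemma degree_mono: "finite F' \<Longrightarrow> F \<subseteq> F' \<Longrightarrow> degree F v \<le> degree F' v"
  unfolding degree_def by (rule card_mono) auto

lemma degree_le_1D:
  assumes "finite F" "degree F v \<le> 1" "e \<in> F" "v \<in> e" "e' \<in> F" "v \<in> e'"
  shows "e = e'"
  using assms by (auto simp: degree_def card_le_Suc0_iff_eq)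

text \<open>Repeatedly replacing the end \<open>x\<close> by its neighbour shortens the path until \<open>x\<close> meets \<open>y\<close>
  or \<open>z\<close>.\<close>

lemma path_ends_le_2:
  assumes "finite F" "\<And>e. e \<in> F \<Longrightarrow> card e = 2" "\<And>v. degree F v \<le> 2"
    and "degree F x \<le> 1" "degree F y \<le> 1" "degree F z \<le> 1"
    and "x \<noteq> y" "x \<noteq> z" "y \<noteq> z" "(x, y) \<in> (adj F)\<^sup>*" "(x, z) \<in> (adj F)\<^sup>*"
  shows False
  using assms
proof (induction "card F" arbitrary: F x rule: less_induct)
  case less
  note fin = less.prems(1) and dx = less.prems(4) and dy = less.prems(5) and dz = less.prems(6)
  obtain x' where e: "{x, x'} \<in> F"
    using less.prems(7,10) by (auto simp: adj_def elim: converse_rtranclE)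
  let ?F = "F - {{x, x'}}"
  have leaf: "e = {x, x'}" if "e \<in> F" "x \<in> e" for e
    using degree_le_1D[OF fin dx that e] by simp
  have "(y, x) \<in> (adj F)\<^sup>*" "(z, x) \<in> (adj F)\<^sup>*"
    using less.prems(10,11) by (auto intro: adj_rtrancl_sym)
  then have "(y, x') \<in> (adj ?F)\<^sup>*" "(z, x') \<in> (adj ?F)\<^sup>*"
    using adj_rtrancl_remove_leaf[of y x F x x'] adj_rtrancl_remove_leaf[of z x F x x']
      leaf less.prems(7,8) by auto
  then have conn: "(x', y) \<in> (adj ?F)\<^sup>*" "(x', z) \<in> (adj ?F)\<^sup>*"
    by (auto intro: adj_rtrancl_sym)
  \<comment> \<open>If \<open>x'\<close> has degree at most 1, the deleted edge was its only one. So
    \<open>x' = y\<close> would isolate \<open>y\<close>, although \<open>z\<close> is still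
    connected to \<open>x'\<close>; the same holds with \<open>y\<close> and \<open>z\<close>
    exchanged.\<close>
  have iso: "x' \<notin> e'" if "degree F x' \<le> 1" "e' \<in> ?F" for e'
    using degree_le_1D[OF fin that(1) _ _ e, of e'] that(2) by auto
  have "x' \<noteq> y"
    using adj_rtrancl_isolated[OF \<open>(z, x') \<in> _\<close>] iso dy less.prems(9) by blast
  moreover have "x' \<noteq> z"
    using adj_rtrancl_isolated[OF \<open>(y, x') \<in> _\<close>] iso dz less.prems(9) by blast
  moreover have dx': "degree ?F x' \<le> 1"
  proof -
    have "{e \<in> ?F. x' \<in> e} = {e \<in> F. x' \<in> e} - {{x, x'}}"
      by auto
    then have "degree ?F x' = degree F x' - 1"
      using e fin by (simp add: degree_def)
    then show ?thesis
      using less.prems(3)[of x'] by simp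
  qed
  moreover have le: "degree ?F v \<le> degree F v" for v
    by (rule degree_mono) (use fin in auto)
  ultimately show False
  proof (intro less.hyps[of ?F x'])
    show "card ?F < card F"
      using fin e by (rule card_Diff1_less)
  qed (use fin conn less.prems(2,9) order_trans[OF le less.prems(3)] order_trans[OF le dy]
      order_trans[OF le dz] in auto)
qed

section \<open>Kempe changes: swapping \<open>a\<close> and \<open>b\<close> on a union of
  components of the \<open>a\<close>-\<open>b\<close> subgraph\<close>

definition kempe_closed :: "'a set set \<Rightarrow> ('a set \<Rightarrow> nat) \<Rightarrow> nat \<Rightarrow> nat \<Rightarrow> 'a set \<Rightarrow> bool" where
  "kempe_closed F c a b K \<longleftrightarrow> (\<forall>e\<in>F. c e \<in> {a, b} \<longrightarrow> e \<inter> K = {} \<or> e \<subseteq> K)"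

definition kempe_swap :: "('a set \<Rightarrow> nat) \<Rightarrow> nat \<Rightarrow> nat \<Rightarrow> 'a set \<Rightarrow> 'a set \<Rightarrow> nat" where
  "kempe_swap c a b K e = (if e \<inter> K = {} then c e else transpose a b (c e))"

text \<open>If the edge meets \<open>K\<close> at its other end, closedness forbids it the colours
  \<open>a\<close> and \<open>b\<close>, and the transposition fixes all others.\<close>

lemma kempe_swap_outside:
  assumes "kempe_closed F c a b K" "e \<in> F" "v \<in> e" "v \<notin> K"
  shows "kempe_swap c a b K e = c e"
  using assms by (auto simp: kempe_closed_def kempe_swap_def transpose_def)

lemma missing_kempe_swap_outside:
  assumes "kempe_closed F c a b K" "v \<notin> K"
  shows "missing F (kempe_swap c a b K) v s \<longleftrightarrow> missing F c v s"
  using kempe_swap_outside[OF assms(1) _ _ assms(2)] by (auto simp: missing_def)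

lemma missing_kempe_swap_inside:
  assumes "v \<in> K"
  shows "missing F (kempe_swap c a b K) v s \<longleftrightarrow> missing F c v (transpose a b s)"
proof -
  have "kempe_swap c a b K e = s \<longleftrightarrow> c e = transpose a b s" if "v \<in> e" for e
    using assms that by (metis disjoint_iff kempe_swap_def transpose_involutory)
  then show ?thesis
    by (simp add: missing_def)
qed

text \<open>At a vertex of \<open>K\<close> the colours of all edges undergo the same permutation,
  and at any other vertex none changes; distinct colours stay distinct either way.\<close>

lemma proper_kempe_swap:
  assumes "proper_edge_colouring F q c" "kempe_closed F c a b K" "a \<in> {1..q}" "b \<in> {1..q}"
  shows "proper_edge_colouring F q (kempe_swap c a b K)"
proof -
  have "kempe_swap c a b K e \<noteq> kempe_swap c a b K e'"
    if e: "e \<in> F" "e' \<in> F" "e \<noteq> e'" "v \<in> e" "v \<in> e'" for e e' v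
  proof -
    have ne: "c e \<noteq> c e'"
      using proper_edge_colouring_inj[OF assms(1) e(1,2,4,5)] e(3) by auto
    show ?thesis
    proof (cases "v \<in> K")
      case True
      then show ?thesis
        using e ne by (auto simp: kempe_swap_def transpose_eq_iff)
    next
      case False
      then show ?thesis
        using kempe_swap_outside[OF assms(2) _ _ False] e ne by simp
    qed
  qed
  moreover have "kempe_swap c a b K e \<in> {1..q}" if "e \<in> F" for e
    using assms(1,3,4) that by (auto simp: proper_edge_colouring_def kempe_swap_def transpose_def)
  ultimately show ?thesis
    unfolding proper_edge_colouring_def by blast
qed

lemma kempe_closed_component:
  assumes "\<And>e. e \<in> F \<Longrightarrow> card e = 2"
  shows "kempe_closed F c a b ((adj {e \<in> F. c e \<in> {a, b}})\<^sup>* `` {u})"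
  unfolding kempe_closed_def
proof (intro ballI impI)
  fix e assume e: "e \<in> F" "c e \<in> {a, b}"
  let ?A = "adj {e \<in> F. c e \<in> {a, b}}"
  obtain s t where st: "e = {s, t}"
    using assms[OF e(1)] by (auto simp: card_2_iff)
  then have "(s, t) \<in> ?A" "(t, s) \<in> ?A"
    using e by (auto simp: adj_def insert_commute)
  then show "e \<inter> ?A\<^sup>* `` {u} = {} \<or> e \<subseteq> ?A\<^sup>* `` {u}"
    unfolding st by (auto intro: rtrancl_into_rtrancl)
qed

lemma kempe_component_ends:
  assumes F: "finite F" "\<And>e. e \<in> F \<Longrightarrow> card e = 2" "proper_edge_colouring F q c"
    and m: "missing F c x a" "missing F c y b" "missing F c z b"
    and ne: "x \<noteq> y" "x \<noteq> z" "y \<noteq> z"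
  defines "A \<equiv> adj {e \<in> F. c e \<in> {a, b}}"
  shows "(x, y) \<notin> A\<^sup>* \<or> (x, z) \<notin> A\<^sup>*"
proof (rule ccontr)
  let ?F = "{e \<in> F. c e \<in> {a, b}}"
  assume "\<not> ?thesis"
  then have conn: "(x, y) \<in> (adj ?F)\<^sup>*" "(x, z) \<in> (adj ?F)\<^sup>*"
    by (auto simp: A_def)
  \<comment> \<open>The colouring is injective on the edges at \<open>v\<close>, so their number is
    bounded by that of the colours they may use.\<close>
  have deg: "degree ?F v \<le> card S" if "\<And>e. \<lbrakk>e \<in> ?F; v \<in> e\<rbrakk> \<Longrightarrow> c e \<in> S" "finite S" for v S
  proof -
    have "inj_on c {e \<in> ?F. v \<in> e}"
      using F(3) by (auto simp: inj_on_def proper_edge_colouring_def)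
    then show ?thesis
      unfolding degree_def using that by (intro card_inj_on_le[of c]) auto
  qed
  have "degree ?F v \<le> 2" for v
    using deg[of v "{a, b}"] by (auto intro: order_trans simp: card_insert_if split: if_splits)
  moreover have "degree ?F x \<le> 1" "degree ?F y \<le> 1" "degree ?F z \<le> 1"
    using deg[of x "{b}"] deg[of y "{a}"] deg[of z "{a}"] m by (auto simp: missing_def)
  ultimately show False
    using path_ends_le_2[of ?F x y z] F(1,2) ne conn by auto
qed

section \<open>Fans and Vizing's theorem\<close>

text \<open>The edge from \<open>x\<close> to the first vertex of a fan is uncoloured.\<close>

definition fan :: "'a set set \<Rightarrow> ('a set \<Rightarrow> nat) \<Rightarrow> 'a \<Rightarrow> 'a list \<Rightarrow> bool" where
  "fan E c x ys \<longleftrightarrow> ys \<noteq> [] \<and> distinct ys \<and> (\<forall>y\<in>set ys. {x, y} \<in> E) \<and>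
     (\<forall>i. Suc i < length ys \<longrightarrow> missing (E - {{x, hd ys}}) c (ys ! i) (c {x, ys ! Suc i}))"

text \<open>One shift gives \<open>{x, y}\<close> the colour of \<open>{x, z}\<close> and makes
  \<open>{x, z}\<close> the uncoloured edge. That colour is missing at \<open>y\<close> and used at
  \<open>x\<close> only by \<open>{x, z}\<close>, so the colouring stays proper and the rest of the
  list is again a fan. The last edge gets \<open>a\<close>.\<close>

lemma fan_rotate:
  assumes "fan E c x (y # ys)" "proper_edge_colouring (E - {{x, y}}) q c"
    and "x \<notin> set (y # ys)" "a \<in> {1..q}"
    and "missing (E - {{x, y}}) c x a" "missing (E - {{x, y}}) c (last (y # ys)) a"
  shows "\<exists>c'. proper_edge_colouring E q c'"
  using assms
proof (induction ys arbitrary: c y)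
  case Nil
  have m: "c e \<noteq> a" if "e \<in> E" "e \<noteq> {x, y}" "v \<in> e" "v \<in> {x, y}" for e v
    using Nil.prems(5,6) that by (auto simp: missing_def)
  have "proper_edge_colouring E q (c({x, y} := a))"
  proof (rule proper_edge_colouringI)
    show "(c({x, y} := a)) e \<in> {1..q}" if "e \<in> E" for e
      using proper_edge_colouring_range[OF Nil.prems(2)] Nil.prems(4) that by auto
  next
    fix e e' v assume e: "e \<in> E" "e' \<in> E" "e \<noteq> e'" "v \<in> e" "v \<in> e'"
    then show "(c({x, y} := a)) e \<noteq> (c({x, y} := a)) e'"
      using m[of e v] m[of e' v] proper_edge_colouring_inj[OF Nil.prems(2), of e e' v]
      by (cases "e = {x, y}"; cases "e' = {x, y}") auto
  qed
  then show ?case by blast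
next
  case (Cons z zs)
  let ?F = "E - {{x, y}}" and ?F' = "E - {{x, z}}" and ?c = "c({x, y} := c {x, z})"
  have yz: "{x, y} \<noteq> {x, z}" and xz: "{x, z} \<in> ?F"
    using Cons.prems(1) by (auto simp: fan_def doubleton_eq_iff)
  have my: "missing ?F c y (c {x, z})"
    using Cons.prems(1) by (auto simp: fan_def)
  have mx: "c e \<noteq> c {x, z}" if "e \<in> ?F" "e \<noteq> {x, z}" "x \<in> e" for e
    using proper_edge_colouring_inj[OF Cons.prems(2) that(1) xz, of x] that by auto
  \<comment> \<open>The only new coloured edge is \<open>{x, y}\<close>. It does not affect a vertex
    other than \<open>x\<close> and \<open>y\<close>, and at \<open>x\<close> its colour differs
    from \<open>a\<close>, being the colour of \<open>{x, z}\<close>.\<close>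
  have mi: "missing ?F' ?c v s" if "missing ?F c v s" "v \<noteq> y" "v = x \<Longrightarrow> s = a" for v s
    using that xz Cons.prems(5) by (auto simp: missing_def)
  have "proper_edge_colouring ?F' q ?c"
  proof (rule proper_edge_colouringI)
    show "?c e \<in> {1..q}" if "e \<in> ?F'" for e
      using proper_edge_colouring_range[OF Cons.prems(2)] xz that by auto
  next
    fix e e' v assume e: "e \<in> ?F'" "e' \<in> ?F'" "e \<noteq> e'" "v \<in> e" "v \<in> e'"
    have new: "c d \<noteq> c {x, z}" if "d \<in> ?F'" "d \<noteq> {x, y}" "v \<in> d" "v \<in> {x, y}" for d
      using that mx[of d] my by (auto simp: missing_def)
    consider "e = {x, y}" | "e' = {x, y}" | "e \<in> ?F" "e' \<in> ?F"
      using e by blast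
    then show "?c e \<noteq> ?c e'"
    proof cases
      case 1
      then show ?thesis using new[of e'] e by auto
    next
      case 2
      then show ?thesis using new[of e] e by auto
    next
      case 3
      then show ?thesis
        using proper_edge_colouring_inj[OF Cons.prems(2) 3 e(4,5)] e(3) by auto
    qed
  qed
  moreover have "fan E ?c x (z # zs)"
    unfolding fan_def
  proof (intro conjI allI impI)
    fix i assume i: "Suc i < length (z # zs)"
    have "missing ?F c ((z # zs) ! i) (c {x, (z # zs) ! Suc i})"
      using Cons.prems(1) i unfolding fan_def by (metis Suc_less_eq length_Cons list.sel(1) nth_Cons_Suc)
    moreover have "(z # zs) ! i \<in> set (z # zs)" "(z # zs) ! Suc i \<in> set (z # zs)"
      using i by (metis Suc_lessD nth_mem, metis nth_mem)
    then have "(z # zs) ! i \<noteq> y" "(z # zs) ! i \<noteq> x" "(z # zs) ! Suc i \<noteq> y"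
      using Cons.prems(1,3) by (auto simp: fan_def)
    moreover have "?c {x, (z # zs) ! Suc i} = c {x, (z # zs) ! Suc i}"
      using \<open>(z # zs) ! Suc i \<noteq> y\<close> by (auto simp: doubleton_eq_iff)
    ultimately show "missing (E - {{x, hd (z # zs)}}) ?c ((z # zs) ! i) (?c {x, (z # zs) ! Suc i})"
      by (simp only: list.sel) (rule mi, auto)
  qed (use Cons.prems(1) in \<open>auto simp: fan_def\<close>)
  moreover have "last (z # zs) \<in> set (z # zs)"
    by (rule last_in_set) simp
  then have "last (z # zs) \<noteq> y" "last (z # zs) \<noteq> x" "x \<noteq> y"
    using Cons.prems(1,3) by (auto simp: fan_def)
  then have "missing ?F' ?c x a" "missing ?F' ?c (last (z # zs)) a"
    using Cons.prems(5,6) by (auto intro: mi)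
  moreover have "x \<notin> set (z # zs)"
    using Cons.prems(3) by simp
  ultimately show ?case
    using Cons.prems(4) by (intro Cons.IH[of ?c z])
qed

lemma fan_take:
  assumes "fan E c x ys" "0 < n"
  shows "fan E c x (take n ys)"
  using assms by (auto simp: fan_def hd_take dest: in_set_takeD)

lemma fan_snoc:
  assumes "fan E c x ys" "v \<notin> set ys" "{x, v} \<in> E"
    and "missing (E - {{x, hd ys}}) c (last ys) (c {x, v})"
  shows "fan E c x (ys @ [v])"
  unfolding fan_def
proof (intro conjI allI impI)
  have ne: "ys \<noteq> []"
    using assms(1) by (simp add: fan_def)
  fix i assume "Suc i < length (ys @ [v])"
  then consider "Suc i < length ys" | "length ys = Suc i"
    by fastforce
  then show "missing (E - {{x, hd (ys @ [v])}}) c ((ys @ [v]) ! i) (c {x, (ys @ [v]) ! Suc i})"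
    by cases (use assms(1,4) ne in \<open>auto simp: fan_def nth_append last_conv_nth\<close>)
qed (use assms(1-3) in \<open>auto simp: fan_def\<close>)

text \<open>As \<open>x\<close> lies outside \<open>K\<close>, the swap keeps \<open>a\<close>
  missing at \<open>x\<close> and the colours of the later fan edges, while \<open>a\<close> becomes
  missing at \<open>last ys\<close>. The fan could break only at a vertex of \<open>K\<close> whose
  next edge has colour \<open>a\<close> or \<open>b\<close>: the first is missing at
  \<open>x\<close>, the second is excluded by assumption.\<close>

lemma fan_kempe_rotate:
  assumes f: "fan E c x ys" and c: "proper_edge_colouring (E - {{x, hd ys}}) q c"
    and x: "x \<notin> set ys" "x \<notin> K" and ab: "a \<in> {1..q}" "b \<in> {1..q}"
    and K: "kempe_closed (E - {{x, hd ys}}) c a b K" "last ys \<in> K"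
    and m: "missing (E - {{x, hd ys}}) c x a" "missing (E - {{x, hd ys}}) c (last ys) b"
    and b: "\<And>i. \<lbrakk>Suc i < length ys; c {x, ys ! Suc i} = b\<rbrakk> \<Longrightarrow> ys ! i \<notin> K"
  shows "\<exists>c'. proper_edge_colouring E q c'"
proof -
  let ?F = "E - {{x, hd ys}}" and ?c = "kempe_swap c a b K"
  have ne: "ys \<noteq> []"
    using f by (simp add: fan_def)
  have "fan E ?c x ys"
    unfolding fan_def
  proof (intro conjI allI impI)
    fix i assume i: "Suc i < length ys"
    let ?s = "c {x, ys ! Suc i}"
    have "hd ys \<noteq> ys ! Suc i"
      using f i ne by (simp add: fan_def hd_conv_nth nth_eq_iff_index_eq)
    then have F: "{x, ys ! Suc i} \<in> ?F"
      using f i by (auto simp: fan_def doubleton_eq_iff)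
    then have "?c {x, ys ! Suc i} = ?s" "?s \<noteq> a"
      using kempe_swap_outside[OF K(1) F _ x(2)] m(1) by (auto simp: missing_def)
    moreover have "missing ?F c (ys ! i) ?s"
      using f i by (simp add: fan_def)
    moreover have "transpose a b ?s = ?s" if "ys ! i \<in> K"
      using b[OF i] that \<open>?s \<noteq> a\<close> by (auto simp: transpose_def)
    ultimately show "missing ?F ?c (ys ! i) (?c {x, ys ! Suc i})"
      using missing_kempe_swap_outside[OF K(1), of "ys ! i" ?s]
        missing_kempe_swap_inside[of "ys ! i" K ?F c a b ?s]
      by (cases "ys ! i \<in> K") simp_all
  qed (use f in \<open>auto simp: fan_def\<close>)
  moreover have "missing ?F ?c x a" "missing ?F ?c (last ys) a"
    using m missing_kempe_swap_outside[OF K(1) x(2)] missing_kempe_swap_inside[OF K(2)] by auto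
  ultimately show ?thesis
    using fan_rotate[of E ?c x "hd ys" "tl ys" q a] proper_kempe_swap[OF c K(1) ab] ne x(1) ab(1)
    by simp
qed

text \<open>Fan vertices are distinct elements of the finite set \<open>\<Union>E\<close>, which
  bounds the length; \<open>[y]\<close> is a fan to start from.\<close>

lemma longest_fan:
  assumes "finite E" "\<And>e. e \<in> E \<Longrightarrow> card e = 2" "{x, y} \<in> E"
  obtains ys where "fan E c x ys" "hd ys = y" "\<And>v. \<not> fan E c x (ys @ [v])"
proof -
  let ?P = "\<lambda>ys. fan E c x ys \<and> hd ys = y"
  have fin: "finite (\<Union>E)"
    by (rule finite_Union[OF assms(1)]) (metis assms(2) card.infinite zero_neq_numeral)
  have "length ys \<le> card (\<Union>E)" if "?P ys" for ys
  proof -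
    have "set ys \<subseteq> \<Union>E"
      using that by (auto simp: fan_def)
    then show ?thesis
      using that fin by (metis card_mono distinct_card fan_def)
  qed
  then have "\<forall>ys. ?P ys \<longrightarrow> length ys < Suc (card (\<Union>E))"
    by (simp add: less_Suc_eq_le)
  moreover have "?P [y]"
    using assms(3) by (simp add: fan_def)
  ultimately obtain ys where ys: "?P ys" "\<forall>zs. ?P zs \<longrightarrow> length zs \<le> length ys"
    using ex_has_greatest_nat[of ?P "[y]" length] by blast
  show thesis
  proof (rule that[of ys])
    fix v
    have "hd (ys @ [v]) = y"
      using ys(1) by (auto simp: fan_def)
    then show "\<not> fan E c x (ys @ [v])"
      using ys(2) by force
  qed (use ys(1) in auto)
qed

lemma vizing_step:
  assumes E: "finite E" "\<And>e. e \<in> E \<Longrightarrow> card e = 2" "\<And>v. degree E v < q"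
    and e: "{x, y} \<in> E" and c: "proper_edge_colouring (E - {{x, y}}) q c"
  shows "\<exists>c'. proper_edge_colouring E q c'"
proof -
  let ?F = "E - {{x, y}}"
  obtain ys where f: "fan E c x ys" and y: "hd ys = y"
    and mx: "\<And>v. \<not> fan E c x (ys @ [v])"
    using longest_fan[OF E(1,2) e] by metis
  have F: "finite ?F" "\<And>e. e \<in> ?F \<Longrightarrow> card e = 2"
    using E(1,2) by auto
  have q: "degree ?F v < q" for v
    using degree_mono[of E ?F v] E(1,3) by (meson Diff_subset order_le_less_trans)
  have ne: "ys \<noteq> []" "distinct ys"
    using f by (auto simp: fan_def)
  have x: "x \<notin> set ys"
    using f E(2)[of "{x, x}"] by (auto simp: fan_def)
  obtain a where a: "a \<in> {1..q}" "missing ?F c x a"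
    using missing_ex[OF F(1) q] by blast
  obtain b where b: "b \<in> {1..q}" "missing ?F c (last ys) b"
    using missing_ex[OF F(1) q] by blast
  show ?thesis
  proof (cases "missing ?F c x b")
    case True
    have "y # tl ys = ys"
      using y ne(1) by auto
    then show ?thesis
      using fan_rotate[of E c x y "tl ys" q b] True f x b c by simp
  next
    case False
    then obtain d where d: "d \<in> ?F" "x \<in> d" "c d = b"
      by (auto simp: missing_def)
    then obtain v where v: "d = {x, v}"
      using F(2)[OF d(1)] by (auto simp: card_2_iff)
    \<comment> \<open>Otherwise \<open>v\<close> would extend the longest fan, since
      \<open>b\<close>, the colour of \<open>{x, v}\<close>, is missing at
      \<open>last ys\<close>.\<close>
    have "v \<in> set ys"
    proof (rule ccontr)
      assume "v \<notin> set ys"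
      then have "fan E c x (ys @ [v])"
        using fan_snoc[OF f] d v b(2) y by auto
      then show False
        using mx by blast
    qed
    then obtain j where j: "j < length ys" "ys ! j = v"
      by (auto simp: in_set_conv_nth)
    \<comment> \<open>The edge \<open>d\<close> is coloured and the first fan edge is not, so
      \<open>v\<close> has a predecessor in the fan; there \<open>b\<close> is missing.\<close>
    have "j \<noteq> 0"
      using d(1) v y j ne by (auto simp: hd_conv_nth)
    then obtain i where i: "j = Suc i"
      using not0_implies_Suc by blast
    let ?y = "ys ! i" and ?z = "last ys"
    define A where "A = adj {e \<in> ?F. c e \<in> {a, b}}"
    have my: "missing ?F c ?y b"
      using f i j y d(3) v by (auto simp: fan_def)
    have yz: "?y \<noteq> ?z" "?y \<in> set ys" "?z \<in> set ys"
      using i j ne by (auto simp: last_conv_nth nth_eq_iff_index_eq)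
    have closed: "kempe_closed ?F c a b (A\<^sup>* `` {u})" for u
      unfolding A_def by (rule kempe_closed_component) (use F(2) in auto)
    have sy: "(s, t) \<in> A\<^sup>* \<Longrightarrow> (t, s) \<in> A\<^sup>*" for s t
      unfolding A_def by (rule adj_rtrancl_sym)
    have "(x, ?y) \<notin> A\<^sup>* \<or> (x, ?z) \<notin> A\<^sup>*"
      unfolding A_def
      using kempe_component_ends[OF F c a(2) my b(2)] yz x by metis
    then consider "(x, ?y) \<notin> A\<^sup>*" | "(x, ?y) \<in> A\<^sup>*" "(x, ?z) \<notin> A\<^sup>*"
      by blast
    then show ?thesis
    proof cases
      case 1
      \<comment> \<open>Cutting just before \<open>v\<close> makes the fan end at \<open>?y\<close>
        and leaves no coloured fan edge with colour \<open>b\<close>, as \<open>d\<close> is the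
        only such edge at \<open>x\<close>.\<close>
      let ?ws = "take j ys"
      have h: "hd ?ws = y" "last ?ws = ?y"
        using i j y by (simp, simp add: take_Suc_conv_app_nth)
      have nb: "c {x, ys ! Suc k} \<noteq> b" if "Suc k < j" for k
      proof -
        have "ys ! Suc k \<noteq> v" "ys ! Suc k \<noteq> y"
          using j that ne y by (auto simp: hd_conv_nth nth_eq_iff_index_eq)
        then have "{x, ys ! Suc k} \<in> ?F" "{x, ys ! Suc k} \<noteq> d"
          using f j that v by (auto simp: fan_def doubleton_eq_iff)
        then show ?thesis
          using proper_edge_colouring_inj[OF c _ d(1), of "{x, ys ! Suc k}" x] d by auto
      qed
      show ?thesis
      proof (rule fan_kempe_rotate[of E c x ?ws q "A\<^sup>* `` {?y}" a b])
        show "fan E c x ?ws"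
          using fan_take[OF f] i by simp
      qed (use h c x a b my closed nb j 1 sy in \<open>auto dest: in_set_takeD\<close>)
    next
      case 2
      \<comment> \<open>Now \<open>{x, v}\<close> stays in the fan, so only its predecessor
        \<open>?y\<close> matters. It is connected to \<open>x\<close> while \<open>?z\<close> is
        not, hence lies outside the component of \<open>?z\<close>.\<close>
      have nb: "ys ! k \<notin> A\<^sup>* `` {?z}" if "Suc k < length ys" "c {x, ys ! Suc k} = b" for k
      proof -
        have "ys ! Suc k \<noteq> y"
          using that ne y by (auto simp: hd_conv_nth nth_eq_iff_index_eq)
        then have "{x, ys ! Suc k} \<in> ?F"
          using f that by (auto simp: fan_def doubleton_eq_iff)
        then have "{x, ys ! Suc k} = d"
          using proper_edge_colouring_inj[OF c _ d(1), of "{x, ys ! Suc k}" x] d that(2) by auto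
        then have "k = i"
          using v i j that(1) ne by (auto simp: doubleton_eq_iff nth_eq_iff_index_eq)
        then show ?thesis
          using 2 sy by (auto intro: rtrancl_trans)
      qed
      show ?thesis
        by (rule fan_kempe_rotate[of E c x ys q "A\<^sup>* `` {?z}" a b])
          (use f y c x a b closed nb 2 sy in auto)
    qed
  qed
qed

text \<open>The bound \<open>d\<close> stays fixed while edges are added, since subgraphs have
  smaller degrees; \<open>d + 1\<close> colours always leave one missing at each vertex.\<close>

theorem vizing:
  assumes "finite E" "\<And>e. e \<in> E \<Longrightarrow> card e = 2" "\<And>v. degree E v \<le> d"
  shows "\<exists>c. proper_edge_colouring E (d + 1) c"
  using assms
proof (induction E rule: finite_induct)
  case empty
  then show ?case by (simp add: proper_edge_colouring_def)
next
  case (insert e E)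
  have "degree E v \<le> d" for v
    using degree_mono[of "insert e E" E v] insert.hyps(1) insert.prems(2)[of v] by force
  then obtain c where "proper_edge_colouring E (d + 1) c"
    using insert.IH insert.prems(1) by blast
  moreover obtain x y where "e = {x, y}"
    using insert.prems(1)[of e] by (auto simp: card_2_iff)
  ultimately show ?case
    using vizing_step[of "insert e E" "d + 1" x y c] insert.hyps insert.prems
    by (simp add: less_Suc_eq_le)
qed

section \<open>Realizations by proper edge colourings\<close>

theorem corollary2p5:
  fixes V :: "'a set" and E :: "'a set set"
  assumes "finite_simple_graph V E"
  shows "(\<forall>q c \<gamma>. proper_edge_colouring E q c \<and> edge_scalars E \<gamma> \<longrightarrow>
            jacobi_on (functions_on V (Cpow q)) (graph_bracket V (colour_weight E c \<gamma>))) \<and>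
         (\<exists>q c \<gamma>. q \<le> max_degree V E + 1 \<and>
            proper_edge_colouring E q c \<and> edge_scalars E \<gamma> \<and>
            (\<forall>i j. {i, j} \<in> E \<longrightarrow> colour_weight E c \<gamma> i j \<noteq> 0) \<and>
            jacobi_on (functions_on V (Cpow q)) (graph_bracket V (colour_weight E c \<gamma>)))"
proof -
  have V: "finite V" and E: "\<And>e. e \<in> E \<Longrightarrow> e \<subseteq> V \<and> card e = 2"
    using assms by (auto simp: finite_simple_graph_def)
  have "finite E"
    using V E by (auto intro: finite_subset[of E "Pow V"])
  \<comment> \<open>\<open>vizing\<close> asks for the bound on the whole type, hence the case of
    vertices outside \<open>V\<close>, which have degree 0.\<close>
  moreover have "degree E v \<le> max_degree V E" for v
  proof (cases "v \<in> V")
    case True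
    then show ?thesis
      using V by (simp add: max_degree_def)
  next
    case False
    then have "{e \<in> E. v \<in> e} = {}"
      using E by blast
    then show ?thesis
      by (simp only: degree_def card.empty zero_le)
  qed
  ultimately obtain c where c: "proper_edge_colouring E (max_degree V E + 1) c"
    using vizing E by metis
  have \<gamma>: "edge_scalars E (\<lambda>_ _. 1)"
    by (simp add: edge_scalars_def)
  have "colour_weight E c (\<lambda>_ _. 1) i j \<noteq> 0" if "{i, j} \<in> E" for i j
    using that by (auto simp: colour_weight_def cscale_def idem_def fun_eq_iff)
  then show ?thesis
    using jacobi_on_colour_weight[OF assms] c \<gamma> by blast
qed

end
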